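(* Let $k$ be an infinite field of arbitrary characteristic, $R=k[x_1,\ldots,x_n]$, let $I\subsetneq R$ be a lex-segment ideal, and let $s\ge \dim R/I$ be an integer. Then $$r_s(R/I)=\min\Big\{t\ \Big|\ \dim_k(R/I)_t<\binom{s+t}{t}\Big\}-1.$$
   Context: A lex-segment ideal is a monomial ideal $I$ of $R$ such that if a monomial $x^A$ is in $I$, then $x^B\in I$ for every monomial $x^B$ of the same degree with $x^B\ge x^A$ in the lexicographic order (with $x_1>x_2>\cdots>x_n$). Let $A$ be a standard graded algebra over $k$. An ideal $\mathfrak q=(z_1,\ldots,z_s)$ generated by linear forms $z_1,\ldots,z_s$ of $A$ is called an $s$-reduction of $A$ if $\mathfrak q_t=A_t$ for all $t$ large enough. The reduction number $r_{\mathfrak q}(A)$ is the minimum integer $r\ge 0$ such that $\mathfrak q_{r+1}=A_{r+1}$. The $s$-reduction number of $A$ is $r_s(A)=\min\{r_{\mathfrak q}(A)\mid \mathfrak q=(z_1,\ldots,z_s)\text{ is an } s\text{-reduction of }A\}$. The minimum in the claim is over integers $t\ge 0$. *)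

theory Defs
  imports
    "HOL-Library.Poly_Mapping"
    "HOL-Library.Extended_Nat"
    "HOL-Algebra.QuotRing"
    "HOL-Algebra.Embedded_Algebras"
    "HOL-Algebra.Algebraic_Closure_Type"
begin

section \<open>Krull dimension\<close>

definition krull_dim :: "('a, 'b) ring_scheme \<Rightarrow> enat" where
  "krull_dim A = Sup {enat l | l. \<exists>P :: nat \<Rightarrow> 'a set.
      (\<forall>i\<le>l. primeideal (P i) A) \<and> (\<forall>i<l. P i \<subset> P (Suc i))}"

section \<open>Reduction numbers of graded algebras\<close>

text \<open>A graded algebra is given by a ring \<open>A\<close> and the family \<open>G\<close> of its graded pieces, so that
  \<open>G t\<close> is the piece of degree \<open>t\<close>. For an ideal \<open>q\<close> generated by forms, its piece of degree \<open>t\<close>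
  is \<open>q \<inter> G t\<close>. The linear forms generating \<open>q\<close> may be zero or repeated.\<close>

definition s_reduction ::
  "('a, 'b) ring_scheme \<Rightarrow> (nat \<Rightarrow> 'a set) \<Rightarrow> nat \<Rightarrow> 'a set \<Rightarrow> bool" where
  "s_reduction A G s q \<longleftrightarrow>
     (\<exists>z :: nat \<Rightarrow> 'a. (\<forall>i<s. z i \<in> G 1) \<and> q = Idl\<^bsub>A\<^esub> (z ` {..<s})) \<and>
     (\<exists>t0. \<forall>t\<ge>t0. q \<inter> G t = G t)"

definition reduction_number :: "(nat \<Rightarrow> 'a set) \<Rightarrow> 'a set \<Rightarrow> nat" where
  "reduction_number G q = (LEAST r. q \<inter> G (r + 1) = G (r + 1))"

definition s_reduction_number ::
  "('a, 'b) ring_scheme \<Rightarrow> (nat \<Rightarrow> 'a set) \<Rightarrow> nat \<Rightarrow> nat" where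
  "s_reduction_number A G s =
     (LEAST r. \<exists>q. s_reduction A G s q \<and> r = reduction_number G q)"

section \<open>The polynomial ring in \<open>n\<close> variables\<close>

text \<open>Exponent vectors are finitely supported functions on \<open>nat\<close>; the variables
  \<open>x\<^sub>1, \<dots>, x\<^sub>n\<close> have the indices \<open>0, \<dots>, n - 1\<close>. A polynomial maps exponent vectors to
  coefficients, and the product of the type is the convolution product.\<close>

definition exponents :: "nat \<Rightarrow> (nat \<Rightarrow>\<^sub>0 nat) set" where
  "exponents n = {a. Poly_Mapping.keys a \<subseteq> {..<n}}"

definition total_degree :: "(nat \<Rightarrow>\<^sub>0 nat) \<Rightarrow> nat" where
  "total_degree a = (\<Sum>i\<in>Poly_Mapping.keys a. Poly_Mapping.lookup a i)"

definition monomial :: "(nat \<Rightarrow>\<^sub>0 nat) \<Rightarrow> (nat \<Rightarrow>\<^sub>0 nat) \<Rightarrow>\<^sub>0 'k::field" where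
  "monomial a = Poly_Mapping.single a 1"

definition mpoly_ring :: "nat \<Rightarrow> ((nat \<Rightarrow>\<^sub>0 nat) \<Rightarrow>\<^sub>0 'k::field) ring" where
  "mpoly_ring n = ring_of_type_algebra\<lparr>carrier := {p. Poly_Mapping.keys p \<subseteq> exponents n}\<rparr>"

definition forms :: "nat \<Rightarrow> nat \<Rightarrow> ((nat \<Rightarrow>\<^sub>0 nat) \<Rightarrow>\<^sub>0 'k::field) set" where
  "forms n t = {p \<in> carrier (mpoly_ring n). \<forall>a\<in>Poly_Mapping.keys p. total_degree a = t}"

definition constants :: "((nat \<Rightarrow>\<^sub>0 nat) \<Rightarrow>\<^sub>0 'k::field) set" where
  "constants = range (Poly_Mapping.single 0)"

section \<open>Lex-segment ideals and their quotients\<close>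

definition monomial_ideal :: "nat \<Rightarrow> ((nat \<Rightarrow>\<^sub>0 nat) \<Rightarrow>\<^sub>0 'k::field) set \<Rightarrow> bool" where
  "monomial_ideal n I \<longleftrightarrow> (\<exists>M \<subseteq> exponents n. I = Idl\<^bsub>mpoly_ring n\<^esub> (monomial ` M))"

text \<open>The library order on exponent vectors is lexicographic with the smallest index most
  significant (see \<open>less_poly_mapping\<close> and \<open>less_fun_def\<close>), i.e. \<open>x\<^sub>1 > \<dots> > x\<^sub>n\<close>.\<close>

definition lex_segment_ideal :: "nat \<Rightarrow> ((nat \<Rightarrow>\<^sub>0 nat) \<Rightarrow>\<^sub>0 'k::field) set \<Rightarrow> bool" where
  "lex_segment_ideal n I \<longleftrightarrow> monomial_ideal n I \<and>
     (\<forall>a\<in>exponents n. \<forall>b\<in>exponents n.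
        monomial a \<in> I \<and> total_degree b = total_degree a \<and> b \<ge> a \<longrightarrow> monomial b \<in> I)"

definition quotient_piece ::
  "nat \<Rightarrow> ((nat \<Rightarrow>\<^sub>0 nat) \<Rightarrow>\<^sub>0 'k::field) set \<Rightarrow> nat \<Rightarrow> ((nat \<Rightarrow>\<^sub>0 nat) \<Rightarrow>\<^sub>0 'k) set set" where
  "quotient_piece n I t = (\<lambda>p. I +>\<^bsub>mpoly_ring n\<^esub> p) ` forms n t"

text \<open>The scalars acting on the quotient are the residue classes of the constants, which form
  a subfield isomorphic to the base field when \<open>I\<close> is proper.\<close>

definition hilbert_function ::
  "nat \<Rightarrow> ((nat \<Rightarrow>\<^sub>0 nat) \<Rightarrow>\<^sub>0 'k::field) set \<Rightarrow> nat \<Rightarrow> nat" where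
  "hilbert_function n I t =
     ring.dim (mpoly_ring n Quot I) ((\<lambda>c. I +>\<^bsub>mpoly_ring n\<^esub> c) ` constants) (quotient_piece n I t)"

end

theory Submission
  imports Defs
begin

text \<open>Write \<open>A = R/I\<close>, with variables \<open>x\<^sub>1 > \<dots> > x\<^sub>n\<close>. Everything turns on one condition on a
  degree \<open>t\<close>: that \<open>I\<close> contains all monomials of degree \<open>t\<close> in the first \<open>n - s\<close> variables. For
  \<open>s < n\<close> the least of these monomials is the power of \<open>x\<close> with index \<open>n - s\<close>, so for a lex-segment
  ideal the condition only asks whether this one power lies in \<open>I\<close>. Three facts tie it to the two
  sides of the formula.

  The condition holds if and only if \<open>dim A\<^sub>t\<close> is less than the number of monomials of degree \<open>t\<close> in
  \<open>s + 1\<close> variables (\<open>hilbert_function_less_iff\<close>). The dimension of \<open>A\<^sub>t\<close> is the number of monomials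
  of degree \<open>t\<close> outside \<open>I\<close>. If the power with index \<open>n - s\<close> lies in \<open>I\<close>, then all of these are
  smaller than it and hence are monomials in the last \<open>s + 1\<close> variables, but different from the
  power itself; if it does not lie in \<open>I\<close>, no monomial of degree \<open>t\<close> in the last \<open>s + 1\<close> variables does.

  If the condition holds in degree \<open>t\<close>, then the ideal generated by the last \<open>s\<close> variables contains
  \<open>A\<^sub>t\<close> (\<open>last_variable_classes_generate\<close>), because every monomial of degree \<open>t\<close> is divisible by
  one of them or lies in \<open>I\<close>.

  Conversely, if any \<open>s\<close> linear forms generate an ideal containing \<open>A\<^sub>t\<close> with \<open>t > 0\<close>, the condition
  holds in degree \<open>t\<close> (\<open>reduction_imp_first_variables_absorbed\<close>). Otherwise every monomial of \<open>I\<close>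
  of degree at most \<open>t\<close> involves one of the first \<open>n - s - 1\<close> variables. Now \<open>s\<close> linear forms have
  a common zero \<open>p \<noteq> 0\<close> among the points whose first \<open>n - s - 1\<close> coordinates vanish. All elements
  of degree \<open>t\<close> of \<open>I\<close> and of the ideal of the linear forms vanish at \<open>p\<close>, but the \<open>t\<close>-th power of
  some variable does not.

  So the reduction number of every \<open>s\<close>-reduction is at least \<open>T - 1\<close>, where \<open>T\<close> is the least degree
  with the condition, and the last \<open>s\<close> variables attain this bound. Such a degree exists when
  \<open>s \<ge> dim A\<close> (\<open>first_variables_absorbed_eventually\<close>): otherwise \<open>I\<close> lies in the prime ideal
  generated by the first \<open>n - s - 1\<close> variables, and adding the remaining variables one at a time gives
  a chain of primes of length \<open>s + 1\<close> in \<open>A\<close>.\<close>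

section \<open>Exponent vectors\<close>

lemma total_degree_superset:
  assumes "finite V" "Poly_Mapping.keys a \<subseteq> V"
  shows "total_degree a = (\<Sum>i\<in>V. Poly_Mapping.lookup a i)"
  unfolding total_degree_def using assms
  by (intro sum.mono_neutral_left) (auto simp: in_keys_iff)

lemma keys_add_nat:
  fixes a b :: "nat \<Rightarrow>\<^sub>0 nat"
  shows "Poly_Mapping.keys (a + b) = Poly_Mapping.keys a \<union> Poly_Mapping.keys b"
  by (auto simp: in_keys_iff lookup_add)

lemma total_degree_add: "total_degree (a + b) = total_degree a + total_degree b"
proof -
  have "finite (Poly_Mapping.keys a \<union> Poly_Mapping.keys b)"
    by simp
  then show ?thesis
    by (simp add: total_degree_superset[of "Poly_Mapping.keys a \<union> Poly_Mapping.keys b"]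
        keys_add_nat lookup_add sum.distrib)
qed

lemma total_degree_single [simp]: "total_degree (Poly_Mapping.single i d) = d"
  by (simp add: total_degree_def)

lemma total_degree_zero [simp]: "total_degree 0 = 0"
  by (simp add: total_degree_def)

lemma lookup_le_total_degree: "Poly_Mapping.lookup a i \<le> total_degree a"
proof (cases "i \<in> Poly_Mapping.keys a")
  case True
  then show ?thesis
    unfolding total_degree_def by (intro member_le_sum) auto
qed (simp add: in_keys_iff)

lemma total_degree_eq_0_iff [simp]: "total_degree a = 0 \<longleftrightarrow> a = 0"
proof
  assume deg: "total_degree a = 0"
  show "a = 0"
    by (rule poly_mapping_eqI) (use lookup_le_total_degree[of a] deg in simp)
qed simp

lemma exponents_add: "a \<in> exponents n \<Longrightarrow> b \<in> exponents n \<Longrightarrow> a + b \<in> exponents n"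
  by (auto simp: exponents_def keys_add_nat)

lemma zero_in_exponents [simp]: "0 \<in> exponents n"
  by (simp add: exponents_def)

lemma single_in_exponents: "i < n \<Longrightarrow> Poly_Mapping.single i d \<in> exponents n"
  by (simp add: exponents_def)

lemma exponents_mono: "m \<le> n \<Longrightarrow> exponents m \<subseteq> exponents n"
  by (auto simp: exponents_def)

lemma split_off_variable:
  assumes "i \<in> Poly_Mapping.keys a"
  obtains b where "a = b + Poly_Mapping.single i (1::nat)"
    "Poly_Mapping.keys b \<subseteq> Poly_Mapping.keys a" "total_degree a = Suc (total_degree b)"
proof -
  define b where "b = a - Poly_Mapping.single i (1::nat)"
  have "a = b + Poly_Mapping.single i 1"
    using assms by (intro poly_mapping_eqI) (auto simp: b_def lookup_add lookup_minus lookup_single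
        in_keys_iff when_def)
  moreover from this have "Poly_Mapping.keys b \<subseteq> Poly_Mapping.keys a"
    using keys_add_nat[of b "Poly_Mapping.single i 1"] by auto
  moreover have "total_degree a = Suc (total_degree b)"
    by (subst \<open>a = b + Poly_Mapping.single i 1\<close>) (simp add: total_degree_add)
  ultimately show thesis using that by blast
qed

text \<open>Stars and bars: along an enumeration of \<open>V\<close>, these exponent vectors are the lists of length
  \<open>card V\<close> with sum \<open>t\<close>.\<close>

lemma finite_card_exponents_of_degree:
  assumes "finite V"
  shows "finite {a. Poly_Mapping.keys a \<subseteq> V \<and> total_degree a = t}"
    and "card {a. Poly_Mapping.keys a \<subseteq> V \<and> total_degree a = t} = (card V + t - 1) choose t"
proof -
  define l where "l = sorted_list_of_set V"
  have l: "set l = V" "distinct l" "length l = card V"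
    using assms by (simp_all add: l_def)
  let ?E = "{a. Poly_Mapping.keys a \<subseteq> V \<and> total_degree a = t}"
  let ?L = "{xs :: nat list. length xs = card V \<and> sum_list xs = t}"
  have deg: "sum_list (map (Poly_Mapping.lookup a) l) = total_degree a"
    if "Poly_Mapping.keys a \<subseteq> V" for a
    using that by (simp add: total_degree_superset[OF assms] sum_list_distinct_conv_sum_set l)
  have "bij_betw (\<lambda>a. map (Poly_Mapping.lookup a) l) ?E ?L"
    unfolding bij_betw_def
  proof
    show "inj_on (\<lambda>a. map (Poly_Mapping.lookup a) l) ?E"
    proof (rule inj_onI, rule poly_mapping_eqI)
      fix a b :: "nat \<Rightarrow>\<^sub>0 nat" and i
      assume ab: "a \<in> ?E" "b \<in> ?E"
        and eq: "map (Poly_Mapping.lookup a) l = map (Poly_Mapping.lookup b) l"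
      show "Poly_Mapping.lookup a i = Poly_Mapping.lookup b i"
      proof (cases "i \<in> V")
        case True
        with eq show ?thesis using l(1) by simp
      next
        case False
        with ab have "i \<notin> Poly_Mapping.keys a" "i \<notin> Poly_Mapping.keys b" by auto
        then show ?thesis by (simp add: in_keys_iff)
      qed
    qed
    show "(\<lambda>a. map (Poly_Mapping.lookup a) l) ` ?E = ?L"
    proof (intro equalityI subsetI)
      fix xs assume "xs \<in> (\<lambda>a. map (Poly_Mapping.lookup a) l) ` ?E"
      then show "xs \<in> ?L" using deg l(3) by auto
    next
      fix xs assume xs: "xs \<in> ?L"
      define a where "a = (\<Sum>j<length l. Poly_Mapping.single (l ! j) (xs ! j))"
      have look: "Poly_Mapping.lookup a (l ! k) = xs ! k" if "k < length l" for k
      proof -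
        have "Poly_Mapping.lookup a (l ! k) = (\<Sum>j<length l. if j = k then xs ! j else 0)"
          unfolding a_def lookup_sum lookup_single using that l(2)
          by (intro sum.cong) (auto simp: when_def nth_eq_iff_index_eq)
        then show ?thesis using that by simp
      qed
      have "Poly_Mapping.keys a \<subseteq> (\<Union>j<length l. Poly_Mapping.keys (Poly_Mapping.single (l ! j) (xs ! j)))"
        unfolding a_def by (rule keys_sum)
      also have "\<dots> \<subseteq> V"
        using l(1) by (auto split: if_splits)
      finally have V: "Poly_Mapping.keys a \<subseteq> V" .
      have eq: "map (Poly_Mapping.lookup a) l = xs"
        using xs look l(3) by (intro nth_equalityI) auto
      with V xs have "a \<in> ?E" using deg[OF V] by auto
      with eq show "xs \<in> (\<lambda>a. map (Poly_Mapping.lookup a) l) ` ?E" by blast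
    qed
  qed
  moreover have "finite ?L"
  proof (rule finite_subset)
    show "?L \<subseteq> {xs. set xs \<subseteq> {..t} \<and> length xs = card V}"
      using member_le_sum_list by auto
  qed (simp add: finite_lists_length_eq)
  ultimately show "finite ?E" "card ?E = (card V + t - 1) choose t"
    using bij_betw_finite bij_betw_same_card card_length_sum_list[of "card V" t]
    by (fastforce simp: add.commute)+
qed

lemma lex_less_iff:
  fixes a b :: "nat \<Rightarrow>\<^sub>0 nat"
  shows "a < b \<longleftrightarrow> (\<exists>k. Poly_Mapping.lookup a k < Poly_Mapping.lookup b k \<and>
      (\<forall>i<k. Poly_Mapping.lookup a i = Poly_Mapping.lookup b i))"
  by (simp add: less_poly_mapping.rep_eq less_fun_def)

text \<open>The first variable that occurs in \<open>b\<close> decides the comparison, and it does not occur in \<open>a\<close>.\<close>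

lemma lex_less_if_early_variable:
  fixes a b :: "nat \<Rightarrow>\<^sub>0 nat"
  assumes "i < m" "Poly_Mapping.lookup b i \<noteq> 0" "\<And>j. j < m \<Longrightarrow> Poly_Mapping.lookup a j = 0"
  shows "a < b"
proof -
  define k where "k = (LEAST i. Poly_Mapping.lookup b i \<noteq> 0)"
  have k: "Poly_Mapping.lookup b k \<noteq> 0" "k \<le> i"
    unfolding k_def using assms(2) by (rule LeastI, intro Least_le)
  have "Poly_Mapping.lookup b j = 0" if "j < k" for j
    using not_less_Least[of j "\<lambda>i. Poly_Mapping.lookup b i \<noteq> 0"] that by (simp add: k_def)
  with k assms show ?thesis
    unfolding lex_less_iff by (intro exI[of _ k]) auto
qed

text \<open>In each degree, the pure power of the variable with index \<open>m\<close> separates the monomials in the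
  variables up to \<open>m\<close> from those in the variables from \<open>m\<close> on.\<close>

lemma lex_le_if_disjoint_blocks:
  fixes a b :: "nat \<Rightarrow>\<^sub>0 nat"
  assumes "total_degree a = total_degree b"
    and b: "\<And>i. m < i \<Longrightarrow> Poly_Mapping.lookup b i = 0"
    and a: "\<And>i. i < m \<Longrightarrow> Poly_Mapping.lookup a i = 0"
  shows "a \<le> b"
proof (cases "\<exists>i<m. Poly_Mapping.lookup b i \<noteq> 0")
  case True
  then show ?thesis using lex_less_if_early_variable a by (meson order.strict_implies_order)
next
  case False
  \<comment> \<open>Here \<open>b\<close> is a pure power of the variable with index \<open>m\<close>.\<close>
  have "b = Poly_Mapping.single m (Poly_Mapping.lookup b m)"
    using False b by (intro poly_mapping_eqI) (metis lookup_single_eq lookup_single_not_eq nat_neq_iff)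
  then have "total_degree b = Poly_Mapping.lookup b m"
    by (metis total_degree_single)
  then have le: "Poly_Mapping.lookup a m \<le> Poly_Mapping.lookup b m"
    using lookup_le_total_degree[of a m] assms(1) by simp
  show ?thesis
  proof (cases "Poly_Mapping.lookup a m = Poly_Mapping.lookup b m")
    case True
    have "Poly_Mapping.lookup a i = Poly_Mapping.lookup b i" for i
    proof (cases "i < m \<or> i = m")
      case False
      have "(\<Sum>j\<in>{i, m}. Poly_Mapping.lookup a j) \<le> total_degree a"
        by (subst total_degree_superset[of "{i, m} \<union> Poly_Mapping.keys a"]) (auto intro!: sum_mono2)
      with False True \<open>total_degree b = _\<close> assms(1) b show ?thesis by auto
    qed (use True False a \<open>\<not> (\<exists>i<m. Poly_Mapping.lookup b i \<noteq> 0)\<close> in auto)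
    then have "a = b" by (rule poly_mapping_eqI)
    then show ?thesis by simp
  next
    case neq: False
    then show ?thesis
      using le False a by (intro less_imp_le) (auto simp: lex_less_iff intro!: exI[of _ m])
  qed
qed

section \<open>The polynomial ring and its monomial ideals\<close>

lemma mpoly_ring_simps [simp]:
  "carrier (mpoly_ring n) = {p. Poly_Mapping.keys p \<subseteq> exponents n}"
  "x \<otimes>\<^bsub>mpoly_ring n\<^esub> y = x * y"
  "x \<oplus>\<^bsub>mpoly_ring n\<^esub> y = x + y"
  "\<one>\<^bsub>mpoly_ring n\<^esub> = 1"
  "\<zero>\<^bsub>mpoly_ring n\<^esub> = 0"
  by (simp_all add: mpoly_ring_def ring_of_type_algebra_def)

lemma monomial_0 [simp]: "monomial 0 = 1"
  by (simp add: monomial_def)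

lemma monomial_add: "monomial (a + b) = monomial a * monomial b"
  by (simp add: monomial_def mult_single)

lemma keys_monomial [simp]: "Poly_Mapping.keys (monomial a) = {a}"
  by (simp add: monomial_def)

lemma poly_mapping_eq_sum_monomials:
  "p = (\<Sum>a\<in>Poly_Mapping.keys p. Poly_Mapping.single 0 (Poly_Mapping.lookup p a) * monomial a)"
proof (rule poly_mapping_eqI)
  fix b
  have "(\<Sum>a\<in>Poly_Mapping.keys p. Poly_Mapping.lookup p a when a = b) = Poly_Mapping.lookup p b"
    by (cases "b \<in> Poly_Mapping.keys p") (auto simp: when_def in_keys_iff)
  then show "Poly_Mapping.lookup p b = Poly_Mapping.lookup (\<Sum>a\<in>Poly_Mapping.keys p.
      Poly_Mapping.single 0 (Poly_Mapping.lookup p a) * monomial a) b"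
    by (simp add: lookup_sum monomial_def mult_single lookup_single)
qed

text \<open>The terms of \<open>p\<close> with exponents in \<open>A\<close> and the remaining terms do not cancel each other, so that
  the supports are exactly the two parts of the support of \<open>p\<close>.\<close>

lemma split_by_exponents:
  fixes p :: "'a \<Rightarrow>\<^sub>0 'b::ab_group_add"
  obtains q where "Poly_Mapping.keys q = Poly_Mapping.keys p \<inter> A"
    "Poly_Mapping.keys (p - q) = Poly_Mapping.keys p - A"
proof -
  define q where "q = Poly_Mapping.mapp (\<lambda>a c. c when a \<in> A) p"
  have look: "Poly_Mapping.lookup q a = (if a \<in> A then Poly_Mapping.lookup p a else 0)" for a
    by (simp add: q_def lookup_mapp when_def in_keys_iff)
  show thesis
    by (rule that[of q]) (auto simp: in_keys_iff lookup_minus look split: if_splits)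
qed

lemma mult_in_mpoly_carrier:
  assumes "Poly_Mapping.keys p \<subseteq> exponents n" "Poly_Mapping.keys q \<subseteq> exponents n"
  shows "Poly_Mapping.keys (p * q) \<subseteq> exponents n"
  using keys_mult[of p q] assms exponents_add by blast

lemma cring_mpoly_ring: "cring (mpoly_ring n :: ((nat \<Rightarrow>\<^sub>0 nat) \<Rightarrow>\<^sub>0 'k::field) ring)"
proof -
  let ?T = "ring_of_type_algebra :: ((nat \<Rightarrow>\<^sub>0 nat) \<Rightarrow>\<^sub>0 'k) ring"
  interpret T: cring ?T
    by (rule cring_from_type_algebra)
  have [simp]: "carrier ?T = UNIV" "\<And>x y. x \<otimes>\<^bsub>?T\<^esub> y = x * y" "\<And>x y. x \<oplus>\<^bsub>?T\<^esub> y = x + y"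
    "\<one>\<^bsub>?T\<^esub> = 1" "\<zero>\<^bsub>?T\<^esub> = 0"
    by (simp_all add: ring_of_type_algebra_def)
  have neg: "\<ominus>\<^bsub>?T\<^esub> x = - x" for x
    by (rule T.minus_equality) simp_all
  have "subring (carrier (mpoly_ring n)) ?T"
  proof (rule T.subringI)
    fix p q :: "(nat \<Rightarrow>\<^sub>0 nat) \<Rightarrow>\<^sub>0 'k"
    assume pq: "p \<in> carrier (mpoly_ring n)" "q \<in> carrier (mpoly_ring n)"
    then show "p \<otimes>\<^bsub>?T\<^esub> q \<in> carrier (mpoly_ring n)"
      by (simp add: mult_in_mpoly_carrier)
    show "p \<oplus>\<^bsub>?T\<^esub> q \<in> carrier (mpoly_ring n)"
      using pq Poly_Mapping.keys_add[of p q] by auto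
  qed (auto simp: neg)
  then have "subcring (carrier (mpoly_ring n)) ?T"
    by (rule T.subcringI')
  then have "cring (?T\<lparr>carrier := carrier (mpoly_ring n)\<rparr>)"
    using T.subcring_iff[of "carrier (mpoly_ring n)"] by simp
  then show ?thesis
    by (simp add: mpoly_ring_def)
qed

lemma mpoly_ring_minus:
  assumes "p \<in> carrier (mpoly_ring n)" "q \<in> carrier (mpoly_ring n)"
  shows "p \<ominus>\<^bsub>mpoly_ring n\<^esub> q = p - q"
proof -
  interpret R: cring "mpoly_ring n :: ((nat \<Rightarrow>\<^sub>0 nat) \<Rightarrow>\<^sub>0 'a) ring" by (rule cring_mpoly_ring)
  have "\<ominus>\<^bsub>mpoly_ring n\<^esub> q = - q"
    using assms by (intro R.minus_equality) auto
  then show ?thesis by (simp add: a_minus_def)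
qed

text \<open>Ideal closure in terms of the operations of the polynomial type, with \<open>0\<close>, \<open>+\<close>, \<open>-\<close> and \<open>*\<close>
  in place of the operations of the ring structure.\<close>

lemma mpoly_ideal_props:
  assumes "ideal J (mpoly_ring n)"
  shows "J \<subseteq> carrier (mpoly_ring n)" "0 \<in> J"
    "\<And>p q. p \<in> J \<Longrightarrow> q \<in> J \<Longrightarrow> p + q \<in> J"
    "\<And>p q. p \<in> J \<Longrightarrow> q \<in> J \<Longrightarrow> p - q \<in> J"
    "\<And>p r. p \<in> J \<Longrightarrow> Poly_Mapping.keys r \<subseteq> exponents n \<Longrightarrow> r * p \<in> J"
    "\<And>A f. finite A \<Longrightarrow> (\<And>x. x \<in> A \<Longrightarrow> f x \<in> J) \<Longrightarrow> sum f A \<in> J"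
proof -
  interpret J: ideal J "mpoly_ring n" by fact
  show sub: "J \<subseteq> carrier (mpoly_ring n)" using J.a_subset .
  show zero: "0 \<in> J" 
    using additive_subgroup.zero_closed[OF ideal.axioms(1)[OF assms]] by simp
  show add: "p + q \<in> J" if "p \<in> J" "q \<in> J" for p q
    using additive_subgroup.a_closed[OF ideal.axioms(1)[OF assms] that] by simp
  show mult: "r * p \<in> J" if "p \<in> J" "Poly_Mapping.keys r \<subseteq> exponents n" for p r
    using J.I_l_closed[of p r] that by simp
  show "p - q \<in> J" if "p \<in> J" "q \<in> J" for p q
  proof -
    have "(- 1) * q \<in> J" using that by (intro mult) auto
    with \<open>p \<in> J\<close> have "p + (- 1) * q \<in> J" by (rule add)
    then show ?thesis by simp
  qed
  show "sum f A \<in> J" if "finite A" "\<And>x. x \<in> A \<Longrightarrow> f x \<in> J" for A and f :: "'c \<Rightarrow> _"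
    using that by (induction A rule: finite_induct) (auto simp: zero add)
qed

lemma mpoly_idealI:
  fixes J :: "((nat \<Rightarrow>\<^sub>0 nat) \<Rightarrow>\<^sub>0 'k::field) set"
  assumes "J \<subseteq> carrier (mpoly_ring n)" "0 \<in> J"
    and add: "\<And>p q. p \<in> J \<Longrightarrow> q \<in> J \<Longrightarrow> p + q \<in> J"
    and mult: "\<And>p r. p \<in> J \<Longrightarrow> Poly_Mapping.keys r \<subseteq> exponents n \<Longrightarrow> r * p \<in> J"
  shows "ideal J (mpoly_ring n)"
proof -
  interpret R: cring "mpoly_ring n :: ((nat \<Rightarrow>\<^sub>0 nat) \<Rightarrow>\<^sub>0 'k) ring" by (rule cring_mpoly_ring)
  show ?thesis
  proof (rule idealI)
    show "subgroup J (add_monoid (mpoly_ring n))"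
    proof (rule R.add.subgroupI)
      fix p assume p: "p \<in> J"
      have "\<ominus>\<^bsub>mpoly_ring n\<^esub> p = - p"
        using p assms(1) by (intro R.minus_equality) auto
      moreover have "(- 1) * p \<in> J" using p by (intro mult) auto
      ultimately show "\<ominus>\<^bsub>mpoly_ring n\<^esub> p \<in> J" by simp
    qed (use assms(1,2) add in auto)
    show "r \<otimes>\<^bsub>mpoly_ring n\<^esub> p \<in> J" if "p \<in> J" "r \<in> carrier (mpoly_ring n)" for p r
      using mult[of p r] that by simp
    then show "p \<otimes>\<^bsub>mpoly_ring n\<^esub> r \<in> J" if "p \<in> J" "r \<in> carrier (mpoly_ring n)" for p r
      using that by (simp add: mult.commute)
  qed (rule R.ring_axioms)
qed

lemma ideal_of_exponent_set:
  assumes "N \<subseteq> exponents n" and "\<And>a b. a \<in> N \<Longrightarrow> b \<in> exponents n \<Longrightarrow> a + b \<in> N"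
  shows "ideal {p. Poly_Mapping.keys p \<subseteq> N} (mpoly_ring n)"
proof (rule mpoly_idealI)
  show "p + q \<in> {p. Poly_Mapping.keys p \<subseteq> N}"
    if "p \<in> {p. Poly_Mapping.keys p \<subseteq> N}" "q \<in> {p. Poly_Mapping.keys p \<subseteq> N}" for p q :: "(nat \<Rightarrow>\<^sub>0 nat) \<Rightarrow>\<^sub>0 'a"
    using that Poly_Mapping.keys_add[of p q] by auto
  show "r * p \<in> {p. Poly_Mapping.keys p \<subseteq> N}"
    if "p \<in> {p. Poly_Mapping.keys p \<subseteq> N}" "Poly_Mapping.keys r \<subseteq> exponents n"
    for p r :: "(nat \<Rightarrow>\<^sub>0 nat) \<Rightarrow>\<^sub>0 'a"
    using that keys_mult[of r p] assms(2) by (fastforce simp: add.commute)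
qed (use assms(1) in auto)

lemma monomial_ideal_is_ideal:
  assumes "monomial_ideal n I"
  shows "ideal I (mpoly_ring n)"
proof -
  interpret R: cring "mpoly_ring n :: ((nat \<Rightarrow>\<^sub>0 nat) \<Rightarrow>\<^sub>0 'a) ring" by (rule cring_mpoly_ring)
  show ?thesis
    using assms unfolding monomial_ideal_def
    by (auto intro!: R.genideal_ideal)
qed

text \<open>The polynomials supported on the exponents of the monomials in \<open>I\<close> form an ideal, and it contains
  the generators of \<open>I\<close>. The monomial on the right-hand side matches the left-hand side again, so
  this equivalence does not terminate as a rewrite rule.\<close>

lemma monomial_ideal_mem_iff:
  assumes "monomial_ideal n I"
  shows "p \<in> I \<longleftrightarrow> Poly_Mapping.keys p \<subseteq> {a \<in> exponents n. monomial a \<in> I}"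
proof
  interpret R: cring "mpoly_ring n :: ((nat \<Rightarrow>\<^sub>0 nat) \<Rightarrow>\<^sub>0 'a) ring" by (rule cring_mpoly_ring)
  have I: "ideal I (mpoly_ring n)"
    using assms by (rule monomial_ideal_is_ideal)
  note props = mpoly_ideal_props[OF I]
  let ?N = "{a \<in> exponents n. monomial a \<in> I}"
  {
    assume "p \<in> I"
    obtain M where M: "M \<subseteq> exponents n" "I = Idl\<^bsub>mpoly_ring n\<^esub> (monomial ` M)"
      using assms unfolding monomial_ideal_def by blast
    have "ideal {p. Poly_Mapping.keys p \<subseteq> ?N} (mpoly_ring n)"
    proof (rule ideal_of_exponent_set)
      fix a b assume "a \<in> ?N" "b \<in> exponents n"
      then show "a + b \<in> ?N"
        using props(5)[of "monomial a" "monomial b"]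
        by (auto simp: exponents_add monomial_add mult.commute)
    qed auto
    moreover have "monomial ` M \<subseteq> {p. Poly_Mapping.keys p \<subseteq> ?N}"
    proof
      fix x assume "x \<in> monomial ` M"
      then obtain a where a: "a \<in> M" "x = monomial a" by auto
      have "monomial ` M \<subseteq> I"
        unfolding M(2) using M(1) by (intro R.genideal_self) auto
      with a M(1) show "x \<in> {p. Poly_Mapping.keys p \<subseteq> ?N}" by auto
    qed
    ultimately have "I \<subseteq> {p. Poly_Mapping.keys p \<subseteq> ?N}"
      unfolding M(2) by (rule R.genideal_minimal)
    with \<open>p \<in> I\<close> show "Poly_Mapping.keys p \<subseteq> ?N" by auto
  }
  {
    assume "Poly_Mapping.keys p \<subseteq> ?N"
    then have "(\<Sum>a\<in>Poly_Mapping.keys p. Poly_Mapping.single 0 (Poly_Mapping.lookup p a) * monomial a) \<in> I"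
      by (intro props(6) props(5)) auto
    then show "p \<in> I"
      using poly_mapping_eq_sum_monomials[of p] by simp
  }
qed

lemma monomial_ideal_mult:
  assumes "monomial_ideal n I" "monomial a \<in> I" "b \<in> exponents n"
  shows "monomial (a + b) \<in> I"
  using mpoly_ideal_props(5)[OF monomial_ideal_is_ideal[OF assms(1)] assms(2), of "monomial b"] assms(3)
  by (simp add: monomial_add mult.commute)

lemma one_notin_proper_ideal:
  assumes "ideal I (mpoly_ring n)" "I \<noteq> carrier (mpoly_ring n)"
  shows "1 \<notin> I"
  using ideal.one_imp_carrier[OF assms(1)] assms(2) by auto

section \<open>Images of ideals in quotient rings\<close>

text \<open>Passing to cosets loses no information about an ideal that contains \<open>I\<close>: two representatives of a
  coset differ by an element of \<open>I \<subseteq> J\<close>.\<close>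

lemma (in ring) coset_in_image_iff:
  assumes "ideal I R" "ideal J R" "I \<subseteq> J" "x \<in> carrier R"
  shows "I +> x \<in> (+>) I ` J \<longleftrightarrow> x \<in> J"
proof
  assume "I +> x \<in> (+>) I ` J"
  then obtain y where y: "y \<in> J" "I +> x = I +> y" by auto
  interpret J: ideal J R by fact
  have "x \<ominus> y \<in> J"
    using quotient_eq_iff_same_a_r_cos[OF assms(1,4) J.Icarr[OF y(1)]] y(2) assms(3) by auto
  then have "(x \<ominus> y) \<oplus> y \<in> J" using y(1) by (rule additive_subgroup.a_closed[OF ideal.axioms(1)[OF assms(2)]])
  moreover have "(x \<ominus> y) \<oplus> y = x"
    using assms(4) J.Icarr[OF y(1)] by algebra
  ultimately show "x \<in> J" by simp
qed auto

lemma (in cring) primeideal_image_in_quotient: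
  assumes "ideal I R" "primeideal P R" "I \<subseteq> P"
  shows "primeideal ((+>) I ` P) (R Quot I)"
proof -
  interpret I: ideal I R by fact
  interpret P: primeideal P R by fact
  have mem: "I +> x \<in> (+>) I ` P \<longleftrightarrow> x \<in> P" if "x \<in> carrier R" for x
    using coset_in_image_iff[OF assms(1) P.ideal_axioms assms(3) that] .
  have carr: "carrier (R Quot I) = (+>) I ` carrier R"
    unfolding FactRing_def by (auto simp: A_RCOSETS_def')
  show ?thesis
  proof (rule primeidealI)
    show "ideal ((+>) I ` P) (R Quot I)"
      using ring_ideal_imp_quot_ideal[OF assms(1) P.ideal_axioms] .
    show "cring (R Quot I)"
      using I.quotient_is_cring[OF is_cring] .
    have "\<one> \<notin> P"
      using P.I_notcarr P.one_imp_carrier by auto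
    then show "carrier (R Quot I) \<noteq> (+>) I ` P"
      using mem[OF one_closed] unfolding carr by blast
    fix a b
    assume ab: "a \<in> carrier (R Quot I)" "b \<in> carrier (R Quot I)" "a \<otimes>\<^bsub>R Quot I\<^esub> b \<in> (+>) I ` P"
    then obtain x y where xy: "x \<in> carrier R" "y \<in> carrier R" "a = I +> x" "b = I +> y"
      unfolding carr by blast
    then have "I +> (x \<otimes> y) \<in> (+>) I ` P"
      using ab(3) ring_hom_mult[OF I.rcos_ring_hom] by auto
    then have "x \<otimes> y \<in> P" using mem[of "x \<otimes> y"] xy by simp
    then show "a \<in> (+>) I ` P \<or> b \<in> (+>) I ` P"
      using P.I_prime xy by blast
  qed
qed

section \<open>The Hilbert function counts standard monomials\<close>

definition standard_exponents ::
  "nat \<Rightarrow> ((nat \<Rightarrow>\<^sub>0 nat) \<Rightarrow>\<^sub>0 'k::field) set \<Rightarrow> nat \<Rightarrow> (nat \<Rightarrow>\<^sub>0 nat) set" where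
  "standard_exponents n I t = {a \<in> exponents n. total_degree a = t \<and> monomial a \<notin> I}"

lemma finite_standard_exponents: "finite (standard_exponents n I t)"
  by (rule finite_subset[OF _ finite_card_exponents_of_degree(1)[of "{..<n}" t]])
    (auto simp: standard_exponents_def exponents_def)

text \<open>The scalars of the quotient are the image of the base field under a ring homomorphism, and a
  field maps injectively to every ring in which \<open>1 \<noteq> 0\<close>.\<close>

lemma residue_constants_subfield:
  fixes I :: "((nat \<Rightarrow>\<^sub>0 nat) \<Rightarrow>\<^sub>0 'k::field) set"
  assumes I: "ideal I (mpoly_ring n)" "I \<noteq> carrier (mpoly_ring n)"
  shows "subfield ((\<lambda>c. I +>\<^bsub>mpoly_ring n\<^esub> c) ` constants) (mpoly_ring n Quot I)"
proof -
  let ?R = "mpoly_ring n :: ((nat \<Rightarrow>\<^sub>0 nat) \<Rightarrow>\<^sub>0 'k) ring"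
  let ?F = "ring_of_type_algebra :: 'k ring"
  interpret I: ideal I ?R by fact
  interpret F: field ?F by (rule field_from_type_algebra)
  have F [simp]: "carrier ?F = UNIV" "\<And>x y. x \<otimes>\<^bsub>?F\<^esub> y = x * y" "\<And>x y. x \<oplus>\<^bsub>?F\<^esub> y = x + y"
    "\<one>\<^bsub>?F\<^esub> = 1" "\<zero>\<^bsub>?F\<^esub> = 0"
    by (simp_all add: ring_of_type_algebra_def)
  have "Poly_Mapping.single 0 \<in> ring_hom ?F ?R"
    by (rule ring_hom_memI) (auto simp: mult_single single_add)
  then have hom: "(\<lambda>c. I +>\<^bsub>?R\<^esub> c) \<circ> Poly_Mapping.single 0 \<in> ring_hom ?F (?R Quot I)"
    using I.rcos_ring_hom by (rule ring_hom_trans)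
  interpret h: ring_hom_ring ?F "?R Quot I" "(\<lambda>c. I +>\<^bsub>?R\<^esub> c) \<circ> Poly_Mapping.single 0"
    using hom I.quotient_is_ring F.ring_axioms by (intro ring_hom_ringI2)
  have "subfield (carrier ?F) ?F"
    using F.subfield_iff(1)[of "carrier ?F"] F.field_axioms by (simp add: ring_of_type_algebra_def)
  moreover have "\<one>\<^bsub>?R Quot I\<^esub> \<noteq> \<zero>\<^bsub>?R Quot I\<^esub>"
  proof
    assume "\<one>\<^bsub>?R Quot I\<^esub> = \<zero>\<^bsub>?R Quot I\<^esub>"
    then have "I +>\<^bsub>?R\<^esub> 1 = I"
      by (simp add: FactRing_def)
    then have "1 \<in> I"
      using I.a_rcos_self[of 1] by simp
    then show False using one_notin_proper_ideal[OF I] by simp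
  qed
  ultimately have "subfield (((\<lambda>c. I +>\<^bsub>?R\<^esub> c) \<circ> Poly_Mapping.single 0) ` carrier ?F) (?R Quot I)"
    by (rule h.img_is_subfield(2))
  then show ?thesis
    by (simp add: constants_def image_comp)
qed

text \<open>A linear combination of monomials outside \<open>I\<close> that is zero modulo \<open>I\<close> is itself in \<open>I\<close>, so its
  support consists of exponents of monomials in \<open>I\<close> and is empty. The span is computed in the same
  induction along the list because independence of a list is defined through the spans of its
  tails.\<close>

lemma standard_monomials_independent:
  fixes I :: "((nat \<Rightarrow>\<^sub>0 nat) \<Rightarrow>\<^sub>0 'k::field) set" and n :: nat
  defines "Q \<equiv> mpoly_ring n Quot I"
    and "K \<equiv> (\<lambda>c. I +>\<^bsub>mpoly_ring n\<^esub> c) ` constants"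
  assumes I: "monomial_ideal n I"
    and as: "distinct as" "set as \<subseteq> exponents n" "\<And>a. a \<in> set as \<Longrightarrow> monomial a \<notin> I"
  shows "ring.independent Q K (map (\<lambda>a. I +>\<^bsub>mpoly_ring n\<^esub> monomial a) as)"
    and "ring.Span Q K (map (\<lambda>a. I +>\<^bsub>mpoly_ring n\<^esub> monomial a) as) =
      (\<lambda>p. I +>\<^bsub>mpoly_ring n\<^esub> p) ` {p. Poly_Mapping.keys p \<subseteq> set as}"
proof -
  let ?R = "mpoly_ring n :: ((nat \<Rightarrow>\<^sub>0 nat) \<Rightarrow>\<^sub>0 'k) ring"
  let ?h = "\<lambda>p. I +>\<^bsub>?R\<^esub> p"
  interpret I: ideal I ?R using I by (rule monomial_ideal_is_ideal)
  interpret Q: ring Q unfolding Q_def by (rule I.quotient_is_ring)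
  have h: "?h \<in> ring_hom ?R Q" unfolding Q_def by (rule I.rcos_ring_hom)
  have h_add: "?h p \<oplus>\<^bsub>Q\<^esub> ?h q = ?h (p + q)"
    if "Poly_Mapping.keys p \<subseteq> exponents n" "Poly_Mapping.keys q \<subseteq> exponents n" for p q
    using ring_hom_add[OF h, of p q] that by simp
  have h_mult: "?h p \<otimes>\<^bsub>Q\<^esub> ?h q = ?h (p * q)"
    if "Poly_Mapping.keys p \<subseteq> exponents n" "Poly_Mapping.keys q \<subseteq> exponents n" for p q
    using ring_hom_mult[OF h, of p q] that by simp
  have h_zero: "?h 0 = \<zero>\<^bsub>Q\<^esub>"
    using ring_hom_zero[OF h I.ring_axioms Q.ring_axioms] by simp
  have "Q.independent K (map (\<lambda>a. ?h (monomial a)) as) \<and>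
      Q.Span K (map (\<lambda>a. ?h (monomial a)) as) = ?h ` {p. Poly_Mapping.keys p \<subseteq> set as}"
    using as
  proof (induction as)
    case Nil
    then show ?case by (simp add: h_zero)
  next
    case (Cons a as)
    let ?us = "map (\<lambda>a. ?h (monomial a)) as"
    have IH: "Q.independent K ?us" "Q.Span K ?us = ?h ` {p. Poly_Mapping.keys p \<subseteq> set as}"
      using Cons by auto
    have a: "a \<in> exponents n" "a \<notin> set as" "monomial a \<notin> I" "set as \<subseteq> exponents n"
      using Cons.prems by auto
    have "?h (monomial a) \<notin> Q.Span K ?us"
    proof
      assume "?h (monomial a) \<in> Q.Span K ?us"
      then obtain p where p: "Poly_Mapping.keys p \<subseteq> set as" "?h (monomial a) = ?h p"
        unfolding IH(2) by auto
      have mem: "monomial a \<in> carrier ?R" "p \<in> carrier ?R"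
        using p(1) a by auto
      have "monomial a - p \<in> I"
        using I.quotient_eq_iff_same_a_r_cos[OF I.ideal_axioms mem] p(2) mpoly_ring_minus[OF mem] by simp
      moreover have "Poly_Mapping.lookup p a = 0"
        using p(1) a(2) by (meson in_keys_iff subsetD)
      then have "a \<in> Poly_Mapping.keys (monomial a - p)"
        by (simp add: in_keys_iff lookup_minus monomial_def)
      ultimately show False
        using monomial_ideal_mem_iff[OF I] a(3) by blast
    qed
    moreover have "?h (monomial a) \<in> carrier Q"
      using ring_hom_closed[OF h, of "monomial a"] a by simp
    ultimately have "Q.independent K (?h (monomial a) # ?us)"
      using IH(1) by (intro Q.li_Cons)
    moreover have "Q.Span K (?h (monomial a) # ?us) = ?h ` {p. Poly_Mapping.keys p \<subseteq> insert a (set as)}"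
    proof (intro equalityI subsetI)
      fix Y assume "Y \<in> Q.Span K (?h (monomial a) # ?us)"
      then have "Y \<in> Q.line_extension K (?h (monomial a)) (Q.Span K ?us)" by simp
      then obtain c p where cp: "Poly_Mapping.keys p \<subseteq> set as"
        "Y = ?h (Poly_Mapping.single 0 c) \<otimes>\<^bsub>Q\<^esub> ?h (monomial a) \<oplus>\<^bsub>Q\<^esub> ?h p"
        unfolding Q.line_extension_mem_iff IH(2) unfolding K_def constants_def by blast
      have "Y = ?h (Poly_Mapping.single 0 c * monomial a + p)"
        unfolding cp(2) using cp(1) a
        by (subst h_mult, simp, simp, subst h_add) (auto simp: mult_in_mpoly_carrier)
      moreover have "Poly_Mapping.keys (Poly_Mapping.single 0 c * monomial a + p) \<subseteq> insert a (set as)"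
        using Poly_Mapping.keys_add[of "Poly_Mapping.single 0 c * monomial a" p] cp(1)
        by (auto simp: monomial_def mult_single split: if_splits)
      ultimately show "Y \<in> ?h ` {p. Poly_Mapping.keys p \<subseteq> insert a (set as)}" by blast
    next
      fix Y assume "Y \<in> ?h ` {p. Poly_Mapping.keys p \<subseteq> insert a (set as)}"
      then obtain p where p: "Poly_Mapping.keys p \<subseteq> insert a (set as)" "Y = ?h p" by auto
      define c where "c = Poly_Mapping.lookup p a"
      define q where "q = p - Poly_Mapping.single a c"
      have q: "Poly_Mapping.keys q \<subseteq> set as"
      proof
        fix b assume b: "b \<in> Poly_Mapping.keys q"
        then have "b \<noteq> a" by (auto simp: q_def c_def in_keys_iff lookup_minus)
        moreover from this b have "b \<in> Poly_Mapping.keys p"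
          by (simp add: q_def in_keys_iff lookup_minus lookup_single_not_eq)
        ultimately show "b \<in> set as" using p(1) by auto
      qed
      have "p = Poly_Mapping.single 0 c * monomial a + q"
        by (simp add: q_def monomial_def mult_single)
      moreover have "?h (Poly_Mapping.single 0 c) \<otimes>\<^bsub>Q\<^esub> ?h (monomial a) \<oplus>\<^bsub>Q\<^esub> ?h q =
          ?h (Poly_Mapping.single 0 c * monomial a + q)"
        using q a by (subst h_mult, simp, simp, subst h_add) (auto simp: mult_in_mpoly_carrier)
      ultimately have "Y = ?h (Poly_Mapping.single 0 c) \<otimes>\<^bsub>Q\<^esub> ?h (monomial a) \<oplus>\<^bsub>Q\<^esub> ?h q"
        using p(2) by simp
      then have "Y \<in> Q.line_extension K (?h (monomial a)) (Q.Span K ?us)"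
        unfolding Q.line_extension_mem_iff IH(2) unfolding K_def constants_def using q by blast
      then show "Y \<in> Q.Span K (?h (monomial a) # ?us)" by simp
    qed
    ultimately show ?case by simp
  qed
  then show "Q.independent K (map (\<lambda>a. ?h (monomial a)) as)"
    "Q.Span K (map (\<lambda>a. ?h (monomial a)) as) = ?h ` {p. Poly_Mapping.keys p \<subseteq> set as}"
    by auto
qed

text \<open>Dropping the terms of a form that lie in \<open>I\<close> does not change its residue class.\<close>

lemma quotient_piece_eq_standard:
  fixes I :: "((nat \<Rightarrow>\<^sub>0 nat) \<Rightarrow>\<^sub>0 'k::field) set"
  assumes I: "monomial_ideal n I"
  shows "quotient_piece n I t =
    (\<lambda>p. I +>\<^bsub>mpoly_ring n\<^esub> p) ` {p. Poly_Mapping.keys p \<subseteq> standard_exponents n I t}"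
proof (intro equalityI subsetI)
  let ?R = "mpoly_ring n :: ((nat \<Rightarrow>\<^sub>0 nat) \<Rightarrow>\<^sub>0 'k) ring"
  let ?h = "\<lambda>p. I +>\<^bsub>?R\<^esub> p" and ?S = "standard_exponents n I t"
  interpret I: ideal I ?R using I by (rule monomial_ideal_is_ideal)
  {
    fix Y assume "Y \<in> quotient_piece n I t"
    then obtain p where p: "Y = ?h p" "p \<in> forms n t"
      by (auto simp: quotient_piece_def)
    obtain q where q: "Poly_Mapping.keys q = Poly_Mapping.keys p \<inter> ?S"
      "Poly_Mapping.keys (p - q) = Poly_Mapping.keys p - ?S"
      by (rule split_by_exponents)
    have "p - q \<in> I"
      using p(2) q(2) monomial_ideal_mem_iff[OF I, of "p - q"]
      by (auto simp: forms_def standard_exponents_def)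
    moreover have mem: "p \<in> carrier ?R" "q \<in> carrier ?R"
      using p(2) q(1) by (auto simp: forms_def)
    ultimately have "?h p = ?h q"
      using I.quotient_eq_iff_same_a_r_cos[OF I.ideal_axioms mem] mpoly_ring_minus[OF mem] by simp
    with p(1) q(1) show "Y \<in> ?h ` {p. Poly_Mapping.keys p \<subseteq> ?S}" by blast
  }
  {
    fix Y assume "Y \<in> ?h ` {p. Poly_Mapping.keys p \<subseteq> ?S}"
    then show "Y \<in> quotient_piece n I t"
      by (auto simp: quotient_piece_def forms_def standard_exponents_def)
  }
qed

lemma hilbert_function_eq_card:
  fixes I :: "((nat \<Rightarrow>\<^sub>0 nat) \<Rightarrow>\<^sub>0 'k::field) set"
  assumes I: "monomial_ideal n I" "I \<noteq> carrier (mpoly_ring n)"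
  shows "hilbert_function n I t = card (standard_exponents n I t)"
proof -
  let ?R = "mpoly_ring n :: ((nat \<Rightarrow>\<^sub>0 nat) \<Rightarrow>\<^sub>0 'k) ring"
  let ?K = "(\<lambda>c. I +>\<^bsub>?R\<^esub> c) ` constants"
  have ideal: "ideal I ?R" using I(1) by (rule monomial_ideal_is_ideal)
  interpret Q: ring "?R Quot I" using ideal by (rule ideal.quotient_is_ring)
  obtain as where as: "set as = standard_exponents n I t" "distinct as"
    using finite_distinct_list[OF finite_standard_exponents] by blast
  let ?us = "map (\<lambda>a. I +>\<^bsub>?R\<^esub> monomial a) as"
  have as': "set as \<subseteq> exponents n" "\<And>a. a \<in> set as \<Longrightarrow> monomial a \<notin> I"
    unfolding as(1) by (auto simp: standard_exponents_def)
  have ind: "Q.independent ?K ?us"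
    using I(1) as(2) as' by (rule standard_monomials_independent(1))
  have "Q.Span ?K ?us = (\<lambda>p. I +>\<^bsub>?R\<^esub> p) ` {p. Poly_Mapping.keys p \<subseteq> set as}"
    using I(1) as(2) as' by (rule standard_monomials_independent(2))
  then have span: "Q.Span ?K ?us = quotient_piece n I t"
    by (simp only: as(1) quotient_piece_eq_standard[OF I(1)])
  have "Q.dimension (length ?us) ?K (quotient_piece n I t)"
    using Q.dimension_independent[OF ind] span by simp
  then have "Q.dim ?K (quotient_piece n I t) = length ?us"
    using Q.dimI[OF residue_constants_subfield[OF ideal I(2)]] by (simp add: over_def)
  then show ?thesis
    using distinct_card[OF as(2)] as(1) by (simp add: hilbert_function_def)
qed

section \<open>The Hilbert function and the first variables\<close>

text \<open>The degree condition of the proof idea: modulo the last \<open>s\<close> variables, \<open>I\<close> contains all forms of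
  degree \<open>t\<close>. For \<open>s \<ge> n\<close> no variable is left, and \<open>exponents (n - s)\<close> contains only \<open>0\<close>; then the
  condition holds in all positive degrees, and in degree \<open>0\<close> it says \<open>1 \<in> I\<close>.\<close>

definition first_variables_absorbed ::
  "nat \<Rightarrow> ((nat \<Rightarrow>\<^sub>0 nat) \<Rightarrow>\<^sub>0 'k::field) set \<Rightarrow> nat \<Rightarrow> nat \<Rightarrow> bool" where
  "first_variables_absorbed n I s t \<longleftrightarrow>
     (\<forall>b\<in>exponents (n - s). total_degree b = t \<longrightarrow> monomial b \<in> I)"

lemma first_variables_absorbed_pos:
  assumes "monomial_ideal n I" "I \<noteq> carrier (mpoly_ring n)" "first_variables_absorbed n I s t"
  shows "t > 0"
proof (rule ccontr)
  assume "\<not> t > 0"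
  then have "monomial 0 \<in> I"
    using assms(3) unfolding first_variables_absorbed_def by (metis gr0I total_degree_zero zero_in_exponents)
  then show False
    using one_notin_proper_ideal[OF monomial_ideal_is_ideal[OF assms(1)] assms(2)] by simp
qed

lemma first_variables_absorbed_if_few:
  assumes "n \<le> s" "t > 0"
  shows "first_variables_absorbed n I s t"
  using assms by (auto simp: first_variables_absorbed_def exponents_def)

lemma first_variables_absorbed_Suc:
  assumes "monomial_ideal n I" "first_variables_absorbed n I s t"
  shows "first_variables_absorbed n I s (Suc t)"
  unfolding first_variables_absorbed_def
proof (intro ballI impI)
  fix b assume b: "b \<in> exponents (n - s)" "total_degree b = Suc t"
  then have "b \<noteq> 0" by auto
  then obtain i where i: "i \<in> Poly_Mapping.keys b"
    by (metis all_not_in_conv keys_eq_empty)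
  then obtain c where c: "b = c + Poly_Mapping.single i (1::nat)"
    "Poly_Mapping.keys c \<subseteq> Poly_Mapping.keys b" "total_degree b = Suc (total_degree c)"
    by (rule split_off_variable)
  have "monomial c \<in> I"
    using assms(2) b c(2,3) by (auto simp: first_variables_absorbed_def exponents_def)
  moreover have "Poly_Mapping.single i (1::nat) \<in> exponents n"
    using i b(1) by (intro single_in_exponents) (auto simp: exponents_def)
  ultimately show "monomial b \<in> I"
    unfolding c(1) using monomial_ideal_mult[OF assms(1)] by blast
qed

text \<open>A monomial outside \<open>I\<close> in the first \<open>n - s\<close> variables is at least as large as any monomial of its
  degree in the last \<open>s + 1\<close> variables, so none of these lies in \<open>I\<close>. This extends to degrees below
  \<open>t\<close> because multiplication by a power of the last variable raises the degree to \<open>t\<close> and stays both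
  inside \<open>I\<close> and among the last \<open>s + 1\<close> variables.\<close>

lemma last_variables_avoid_lex_segment:
  assumes lex: "lex_segment_ideal n I" and "s < n" and not: "\<not> first_variables_absorbed n I s t"
    and a: "a \<in> exponents n" "total_degree a \<le> t"
      "\<And>i. i < n - s - 1 \<Longrightarrow> Poly_Mapping.lookup a i = 0"
  shows "monomial a \<notin> I"
proof
  assume aI: "monomial a \<in> I"
  obtain b where b: "b \<in> exponents (n - s)" "total_degree b = t" "monomial b \<notin> I"
    using not by (auto simp: first_variables_absorbed_def)
  \<comment> \<open>The last variable fills the degree up to \<open>t\<close>.\<close>
  define c where "c = a + Poly_Mapping.single (n - 1) (t - total_degree a)"
  have cI: "monomial c \<in> I"
    unfolding c_def using lex aI \<open>s < n\<close>
    by (intro monomial_ideal_mult single_in_exponents) (auto simp: lex_segment_ideal_def)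
  have c: "c \<in> exponents n" "total_degree c = t"
    using a \<open>s < n\<close> by (auto simp: c_def total_degree_add intro!: exponents_add single_in_exponents)
  have "c \<le> b"
  proof (rule lex_le_if_disjoint_blocks[of _ _ "n - s - 1"])
    show "Poly_Mapping.lookup b i = 0" if "n - s - 1 < i" for i
      using that b(1) by (auto simp: exponents_def in_keys_iff subset_iff)
    show "Poly_Mapping.lookup c i = 0" if "i < n - s - 1" for i
      using that a(3) by (simp add: c_def lookup_add lookup_single when_def)
  qed (use b c in simp)
  moreover have "b \<in> exponents n"
    using b(1) exponents_mono[of "n - s" n] by auto
  ultimately have "monomial b \<in> I"
    using lex c cI b(2) unfolding lex_segment_ideal_def by blast
  with b(3) show False ..
qed

text \<open>For \<open>s < n\<close> both sides say that the power of the variable with index \<open>m = n - s - 1\<close> (counting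
  from \<open>0\<close>) lies in \<open>I\<close>: the monomials of degree \<open>t\<close> outside \<open>I\<close> form an initial segment of the
  order, and the monomials up to that power are exactly those in the last \<open>s + 1\<close> variables. For
  \<open>s \<ge> n\<close> both sides say \<open>t > 0\<close>.\<close>

lemma hilbert_function_less_iff:
  fixes I :: "((nat \<Rightarrow>\<^sub>0 nat) \<Rightarrow>\<^sub>0 'k::field) set"
  assumes lex: "lex_segment_ideal n I" and proper: "I \<noteq> carrier (mpoly_ring n)"
  shows "hilbert_function n I t < (s + t) choose t \<longleftrightarrow> first_variables_absorbed n I s t"
proof -
  have mono: "monomial_ideal n I" using lex by (simp add: lex_segment_ideal_def)
  let ?S = "standard_exponents n I t"
  let ?E = "\<lambda>V. {a. Poly_Mapping.keys a \<subseteq> V \<and> total_degree a = t}"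
  have H: "hilbert_function n I t = card ?S"
    by (rule hilbert_function_eq_card[OF mono proper])
  show ?thesis
  proof (cases "s < n")
    case True
    define m where "m = n - s - 1"
    have m: "m < n" "n - s = Suc m" using True by (auto simp: m_def)
    have cardE: "card (?E {m..<n}) = (s + t) choose t"
      using finite_card_exponents_of_degree(2)[of "{m..<n}" t] True by (simp add: m_def)
    show ?thesis
    proof
      assume less: "hilbert_function n I t < (s + t) choose t"
      show "first_variables_absorbed n I s t"
      proof (rule ccontr)
        assume not: "\<not> first_variables_absorbed n I s t"
        have "?E {m..<n} \<subseteq> ?S"
        proof
          fix a assume a: "a \<in> ?E {m..<n}"
          then have "monomial a \<notin> I"
            by (intro last_variables_avoid_lex_segment[OF lex True not])
              (auto simp: exponents_def m_def in_keys_iff subset_iff)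
          with a show "a \<in> ?S"
            by (auto simp: standard_exponents_def exponents_def)
        qed
        then have "card (?E {m..<n}) \<le> card ?S"
          by (rule card_mono[OF finite_standard_exponents])
        with less show False by (simp add: H cardE)
      qed
    next
      assume abs: "first_variables_absorbed n I s t"
      let ?c = "Poly_Mapping.single m t"
      have cI: "monomial ?c \<in> I" "?c \<in> exponents n"
        using abs m single_in_exponents[of m "Suc m" t] single_in_exponents[of m n t]
        by (auto simp: first_variables_absorbed_def)
      have "?S \<subseteq> ?E {m..<n}"
      proof
        fix a assume a: "a \<in> ?S"
        have "Poly_Mapping.lookup a i = 0" if "i < m" for i
        proof (rule ccontr)
          assume "Poly_Mapping.lookup a i \<noteq> 0"
          then have "?c < a"
            using that by (rule_tac lex_less_if_early_variable) (auto simp: lookup_single_not_eq)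
          then have "monomial a \<in> I"
            using lex cI a unfolding lex_segment_ideal_def standard_exponents_def by auto
          with a show False by (simp add: standard_exponents_def)
        qed
        with a show "a \<in> ?E {m..<n}"
          by (force simp: standard_exponents_def exponents_def in_keys_iff not_less[symmetric])
      qed
      moreover have "?c \<in> ?E {m..<n}" "?c \<notin> ?S"
        using m cI by (auto simp: standard_exponents_def)
      ultimately have "?S \<subset> ?E {m..<n}" by blast
      then have "card ?S < card (?E {m..<n})"
        by (intro psubset_card_mono finite_card_exponents_of_degree(1)) auto
      then show "hilbert_function n I t < (s + t) choose t" by (simp add: H cardE)
    qed
  next
    case False
    show ?thesis
    proof (cases "t = 0")
      case True
      have "0 \<in> ?S"
        using one_notin_proper_ideal[OF monomial_ideal_is_ideal[OF mono] proper] True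
        by (simp add: standard_exponents_def)
      then have "card ?S > 0"
        using finite_standard_exponents card_gt_0_iff by blast
      then show ?thesis
        unfolding H using first_variables_absorbed_pos[OF mono proper, of s t] True by auto
    next
      case t: False
      have "?S \<subseteq> ?E {..<n}"
        by (auto simp: standard_exponents_def exponents_def)
      then have "card ?S \<le> card (?E {..<n})"
        by (intro card_mono finite_card_exponents_of_degree(1)) auto
      also have "\<dots> = (n + t - 1) choose t"
        using finite_card_exponents_of_degree(2)[of "{..<n}" t] by simp
      also have "\<dots> \<le> (s + t - 1) choose t"
        using False by (intro binomial_right_mono) auto
      also have "\<dots> < (s + t) choose t"
        using t choose_reduce_nat[of "s + t" t] by simp
      finally show ?thesis
        using first_variables_absorbed_if_few[of n s t I] t False by (simp add: H)
    qed
  qed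
qed

section \<open>Common zeros of few linear forms\<close>

text \<open>Gaussian elimination: a nonzero equation expresses one unknown by the others, which removes one
  equation and one unknown.\<close>

lemma homogeneous_system_has_nonzero_solution:
  fixes c :: "'j \<Rightarrow> 'v \<Rightarrow> 'k::field"
  assumes "finite J" "finite V" "card J < card V"
  shows "\<exists>p. (\<exists>v\<in>V. p v \<noteq> 0) \<and> (\<forall>j\<in>J. (\<Sum>v\<in>V. c j v * p v) = 0)"
  using assms
proof (induction J arbitrary: V c rule: finite_induct)
  case empty
  then have "V \<noteq> {}" by auto
  then show ?case by (auto intro!: exI[of _ "\<lambda>_. 1"])
next
  case (insert j J)
  show ?case
  proof (cases "\<forall>v\<in>V. c j v = 0")
    case True
    have "card J < card V" using insert.prems insert.hyps by simp
    then obtain p where "\<exists>v\<in>V. p v \<noteq> 0" "\<forall>j\<in>J. (\<Sum>v\<in>V. c j v * p v) = 0"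
      using insert.IH[OF insert.prems(1)] by blast
    with True show ?thesis by (intro exI[of _ p]) auto
  next
    case False
    then obtain w where w: "w \<in> V" "c j w \<noteq> 0" by blast
    let ?W = "V - {w}"
    have "card J < card ?W"
      using insert.prems insert.hyps w by simp
    then obtain p where p: "\<exists>v\<in>?W. p v \<noteq> 0"
      "\<forall>i\<in>J. (\<Sum>v\<in>?W. (c i v - c i w * c j v / c j w) * p v) = 0"
      using insert.IH[of ?W "\<lambda>i v. c i v - c i w * c j v / c j w"] insert.prems by auto
    \<comment> \<open>The value at \<open>w\<close> solves equation \<open>j\<close>.\<close>
    define q where "q = p(w := - (\<Sum>v\<in>?W. c j v * p v) / c j w)"
    have eval: "(\<Sum>v\<in>V. c i v * q v) = (\<Sum>v\<in>?W. (c i v - c i w * c j v / c j w) * p v)" for i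
    proof -
      have "(\<Sum>v\<in>V. c i v * q v) = c i w * q w + (\<Sum>v\<in>?W. c i v * q v)"
        using insert.prems(1) w(1) by (rule sum.remove)
      also have "(\<Sum>v\<in>?W. c i v * q v) = (\<Sum>v\<in>?W. c i v * p v)"
        by (intro sum.cong) (auto simp: q_def)
      also have "c i w * q w = - (\<Sum>v\<in>?W. c i w * c j v / c j w * p v)"
        by (simp add: q_def sum_distrib_left sum_divide_distrib sum_negf mult_ac)
      finally show ?thesis
        by (simp add: left_diff_distrib sum_subtractf)
    qed
    have "(\<Sum>v\<in>V. c i v * q v) = 0" if "i \<in> insert j J" for i
      unfolding eval using that p(2) w(2) by auto
    moreover have "\<exists>v\<in>V. q v \<noteq> 0"
      using p(1) by (auto simp: q_def)
    ultimately show ?thesis by blast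
  qed
qed

section \<open>Restriction of polynomials to a line through the origin\<close>

definition monomial_value :: "(nat \<Rightarrow> 'k::field) \<Rightarrow> (nat \<Rightarrow>\<^sub>0 nat) \<Rightarrow> 'k" where
  "monomial_value p a = (\<Prod>i\<in>Poly_Mapping.keys a. p i ^ Poly_Mapping.lookup a i)"

text \<open>The polynomial \<open>f(y p)\<close> in the indeterminate \<open>y\<close>: its coefficient at \<open>y\<close> to the power \<open>d\<close> is the
  value at \<open>p\<close> of the homogeneous component of degree \<open>d\<close> of \<open>f\<close>.\<close>

definition line_restriction ::
  "(nat \<Rightarrow> 'k::field) \<Rightarrow> ((nat \<Rightarrow>\<^sub>0 nat) \<Rightarrow>\<^sub>0 'k) \<Rightarrow> 'k Polynomial.poly" where
  "line_restriction p f = (\<Sum>a\<in>Poly_Mapping.keys f.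
     Polynomial.monom (Poly_Mapping.lookup f a * monomial_value p a) (total_degree a))"

lemma monomial_value_superset:
  assumes "finite V" "Poly_Mapping.keys a \<subseteq> V"
  shows "monomial_value p a = (\<Prod>i\<in>V. p i ^ Poly_Mapping.lookup a i)"
  unfolding monomial_value_def using assms
  by (intro prod.mono_neutral_left) (auto simp: in_keys_iff)

lemma monomial_value_add: "monomial_value p (a + b) = monomial_value p a * monomial_value p b"
proof -
  have "finite (Poly_Mapping.keys a \<union> Poly_Mapping.keys b)"
    by simp
  then show ?thesis
    by (simp add: monomial_value_superset[of "Poly_Mapping.keys a \<union> Poly_Mapping.keys b"]
        keys_add_nat lookup_add power_add prod.distrib)
qed

lemma monomial_value_single: "monomial_value p (Poly_Mapping.single i d) = p i ^ d"
  by (cases "d = 0") (simp_all add: monomial_value_def)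

lemma line_restriction_0 [simp]: "line_restriction p 0 = 0"
  by (simp add: line_restriction_def)

lemma line_restriction_single:
  "line_restriction p (Poly_Mapping.single a c) = Polynomial.monom (c * monomial_value p a) (total_degree a)"
  by (cases "c = 0") (simp_all add: line_restriction_def)

lemma line_restriction_add: "line_restriction p (f + g) = line_restriction p f + line_restriction p g"
  unfolding line_restriction_def
  by (rule setsum_keys_plus_distrib) (simp_all add: distrib_right add_monom)

lemma line_restriction_sum: "line_restriction p (\<Sum>x\<in>A. f x) = (\<Sum>x\<in>A. line_restriction p (f x))"
  by (induction A rule: infinite_finite_induct) (simp_all add: line_restriction_add)

lemma line_restriction_mult: "line_restriction p (f * g) = line_restriction p f * line_restriction p g"
proof -
  have expand: "h = (\<Sum>a\<in>Poly_Mapping.keys h. Poly_Mapping.single a (Poly_Mapping.lookup h a))"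
    for h :: "(nat \<Rightarrow>\<^sub>0 nat) \<Rightarrow>\<^sub>0 'a"
    using poly_mapping_eq_sum_monomials[of h] by (simp add: monomial_def mult_single)
  have "f * g = (\<Sum>a\<in>Poly_Mapping.keys f. \<Sum>b\<in>Poly_Mapping.keys g.
      Poly_Mapping.single (a + b) (Poly_Mapping.lookup f a * Poly_Mapping.lookup g b))"
    by (subst expand[of f], subst expand[of g]) (simp add: sum_product mult_single)
  then show ?thesis
    by (simp add: line_restriction_sum line_restriction_single line_restriction_def[of p f]
        line_restriction_def[of p g] sum_product mult_monom total_degree_add monomial_value_add mult_ac)
qed

section \<open>Reductions of quotients by lex-segment ideals\<close>

text \<open>These are the polynomials whose homogeneous components of degree less than \<open>d\<close> all vanish at \<open>p\<close>.
  Since restriction to the line is a ring homomorphism, they form an ideal.\<close>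

lemma ideal_vanishing_on_line:
  fixes p :: "nat \<Rightarrow> 'k::field"
  shows "ideal {f \<in> carrier (mpoly_ring n). Polynomial.monom 1 d dvd line_restriction p f} (mpoly_ring n)"
proof (rule mpoly_idealI)
  let ?J = "{f \<in> carrier (mpoly_ring n). Polynomial.monom 1 d dvd line_restriction p f}"
  show "f + g \<in> ?J" if "f \<in> ?J" "g \<in> ?J" for f g
    using that Poly_Mapping.keys_add[of f g] by (auto simp: line_restriction_add)
  show "r * f \<in> ?J" if "f \<in> ?J" "Poly_Mapping.keys r \<subseteq> exponents n" for f r
    using that by (auto simp: line_restriction_mult mult_in_mpoly_carrier)
qed auto

text \<open>A linear form restricts to its value at \<open>p\<close> times \<open>y\<close>, so it vanishes on the whole line through
  each of its zeros. Terms with coefficient \<open>0\<close> are added to make the index set independent of the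
  form.\<close>

lemma line_restriction_linear_form:
  assumes "f \<in> forms n 1"
  shows "line_restriction p f =
    Polynomial.monom (\<Sum>i<n. Poly_Mapping.lookup f (Poly_Mapping.single i 1) * p i) 1"
proof -
  have sub: "Poly_Mapping.keys f \<subseteq> (\<lambda>i. Poly_Mapping.single i 1) ` {..<n}"
  proof
    fix a assume a: "a \<in> Poly_Mapping.keys f"
    then have deg: "total_degree a = 1" "a \<in> exponents n"
      using assms by (auto simp: forms_def)
    then have "a \<noteq> 0" by auto
    then obtain i where i: "i \<in> Poly_Mapping.keys a"
      by (metis all_not_in_conv keys_eq_empty)
    then obtain b where "a = b + Poly_Mapping.single i (1::nat)" "total_degree a = Suc (total_degree b)"
      by (rule split_off_variable)
    then have "a = Poly_Mapping.single i 1" using deg by simp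
    with i deg show "a \<in> (\<lambda>i. Poly_Mapping.single i 1) ` {..<n}"
      by (auto simp: exponents_def)
  qed
  have "line_restriction p f = (\<Sum>a\<in>(\<lambda>i. Poly_Mapping.single i 1) ` {..<n}.
      Polynomial.monom (Poly_Mapping.lookup f a * monomial_value p a) (total_degree a))"
    unfolding line_restriction_def using sub
    by (intro sum.mono_neutral_left) (auto simp: in_keys_iff)
  also have "\<dots> = (\<Sum>i<n. Polynomial.monom (Poly_Mapping.lookup f (Poly_Mapping.single i 1) * p i) 1)"
    by (subst sum.reindex) (auto simp: inj_on_def monomial_value_single poly_mapping_eq_iff
        lookup_single fun_eq_iff when_def)
  also have "\<dots> = Polynomial.monom (\<Sum>i<n. Poly_Mapping.lookup f (Poly_Mapping.single i 1) * p i) 1"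
    by (induction n) (simp_all add: add_monom)
  finally show ?thesis .
qed

text \<open>If the condition fails, \<open>I\<close> and the given linear forms have components up to degree \<open>t\<close> that vanish
  at a suitable point \<open>p \<noteq> 0\<close>, and so has every element of the ideal that they generate. But a power of
  a variable with nonzero coordinate at \<open>p\<close> has degree \<open>t\<close> and does not vanish there.\<close>

lemma reduction_imp_first_variables_absorbed:
  fixes I :: "((nat \<Rightarrow>\<^sub>0 nat) \<Rightarrow>\<^sub>0 'k::field) set" and z :: "nat \<Rightarrow> ((nat \<Rightarrow>\<^sub>0 nat) \<Rightarrow>\<^sub>0 'k) set"
  assumes lex: "lex_segment_ideal n I" and "t > 0"
    and z: "\<And>i. i < s \<Longrightarrow> z i \<in> quotient_piece n I 1"
    and sub: "quotient_piece n I t \<subseteq> Idl\<^bsub>mpoly_ring n Quot I\<^esub> (z ` {..<s})"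
  shows "first_variables_absorbed n I s t"
proof (rule ccontr)
  assume not: "\<not> first_variables_absorbed n I s t"
  then have "s < n"
    using first_variables_absorbed_if_few[of n s t I] \<open>t > 0\<close> by (meson not_less)
  let ?R = "mpoly_ring n :: ((nat \<Rightarrow>\<^sub>0 nat) \<Rightarrow>\<^sub>0 'k) ring"
  let ?h = "\<lambda>f. I +>\<^bsub>?R\<^esub> f"
  have mono: "monomial_ideal n I" using lex by (simp add: lex_segment_ideal_def)
  have I: "ideal I ?R" using mono by (rule monomial_ideal_is_ideal)
  interpret R: cring ?R by (rule cring_mpoly_ring)
  interpret Q: ring "?R Quot I" using I by (rule ideal.quotient_is_ring)
  define m where "m = n - s - 1"
  obtain l where l: "\<And>i. i < s \<Longrightarrow> l i \<in> forms n 1" "\<And>i. i < s \<Longrightarrow> z i = ?h (l i)"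
  proof -
    have "\<forall>i. \<exists>f. i < s \<longrightarrow> f \<in> forms n 1 \<and> z i = ?h f"
      using z by (auto simp: quotient_piece_def)
    then show thesis using that by metis
  qed
  have "card {..<s} < card {m..<n}"
    using \<open>s < n\<close> by (simp add: m_def)
  then obtain p0 where p0: "\<exists>v\<in>{m..<n}. p0 v \<noteq> 0"
    "\<forall>i\<in>{..<s}. (\<Sum>v\<in>{m..<n}. Poly_Mapping.lookup (l i) (Poly_Mapping.single v 1) * p0 v) = 0"
    using homogeneous_system_has_nonzero_solution[of "{..<s}" "{m..<n}"
        "\<lambda>i v. Poly_Mapping.lookup (l i) (Poly_Mapping.single v 1)"] by blast
  \<comment> \<open>A nonzero common zero of the \<open>s\<close> linear forms in the space of the last \<open>s + 1\<close> coordinates.\<close>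
  define p where "p v = (if v < m then 0 else p0 v)" for v
  obtain v where v: "v < n" "p v \<noteq> 0"
    using p0(1) by (auto simp: p_def)
  have p_l: "line_restriction p (l i) = 0" if "i < s" for i
  proof -
    have "(\<Sum>v<n. Poly_Mapping.lookup (l i) (Poly_Mapping.single v 1) * p v) =
        (\<Sum>v\<in>{m..<n}. Poly_Mapping.lookup (l i) (Poly_Mapping.single v 1) * p0 v)"
      by (rule sum.mono_neutral_cong_right) (auto simp: p_def)
    then show ?thesis
      using p0(2) that line_restriction_linear_form[OF l(1)[OF that], of p] by simp
  qed
  define J where "J = {f \<in> carrier ?R. Polynomial.monom 1 (Suc t) dvd line_restriction p f}"
  have J: "ideal J ?R"
    unfolding J_def by (rule ideal_vanishing_on_line)
  have "I \<subseteq> J"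
  proof
    fix f assume f: "f \<in> I"
    have "Polynomial.monom 1 (Suc t) dvd line_restriction p f"
      unfolding line_restriction_def
    proof (rule dvd_sum)
      fix a assume "a \<in> Poly_Mapping.keys f"
      then have a: "a \<in> exponents n" "monomial a \<in> I"
        using f monomial_ideal_mem_iff[OF mono, of f] by auto
      let ?g = "Polynomial.monom (Poly_Mapping.lookup f a * monomial_value p a) (total_degree a)"
      show "Polynomial.monom 1 (Suc t) dvd ?g"
      proof (cases "total_degree a \<le> t")
        case True
        then obtain i where i: "i < m" "Poly_Mapping.lookup a i \<noteq> 0"
          using last_variables_avoid_lex_segment[OF lex \<open>s < n\<close> not a(1)] a(2) by (auto simp: m_def)
        then have "monomial_value p a = 0"
          unfolding monomial_value_def by (auto simp: p_def in_keys_iff intro!: bexI[of _ i])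
        then show ?thesis by simp
      next
        case False
        then have "?g = Polynomial.monom 1 (Suc t) *
            Polynomial.monom (Poly_Mapping.lookup f a * monomial_value p a) (total_degree a - Suc t)"
          by (simp add: mult_monom)
        then show ?thesis by (metis dvd_triv_left)
      qed
    qed
    with f show "f \<in> J"
      using mpoly_ideal_props(1)[OF I] by (auto simp: J_def)
  qed
  have "z ` {..<s} \<subseteq> ?h ` J"
    using l p_l by (fastforce simp: J_def forms_def)
  then have "Idl\<^bsub>?R Quot I\<^esub> (z ` {..<s}) \<subseteq> ?h ` J"
    by (intro Q.genideal_minimal R.ring_ideal_imp_quot_ideal I J)
  moreover have "monomial (Poly_Mapping.single v t) \<in> forms n t"
    using v by (auto simp: forms_def single_in_exponents)
  ultimately have "?h (monomial (Poly_Mapping.single v t)) \<in> ?h ` J"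
    using sub by (auto simp: quotient_piece_def)
  then have "monomial (Poly_Mapping.single v t) \<in> J"
    using R.coset_in_image_iff[OF I J \<open>I \<subseteq> J\<close>, of "monomial (Poly_Mapping.single v t)"] v
    by (simp add: single_in_exponents)
  then have "Polynomial.monom 1 (Suc t) dvd Polynomial.monom (p v ^ t) t"
    by (simp add: J_def monomial_def line_restriction_single monomial_value_single)
  moreover have "Polynomial.monom (p v ^ t) t \<noteq> 0"
    using v by simp
  ultimately have "Polynomial.degree (Polynomial.monom (1::'k) (Suc t)) \<le> Polynomial.degree (Polynomial.monom (p v ^ t) t)"
    by (rule dvd_imp_degree_le)
  then show False
    using v by (simp add: degree_monom_eq)
qed

text \<open>The last variable comes first, and zeros follow after all variables are listed: an
  \<open>s\<close>-reduction needs \<open>s\<close> generators also for \<open>s > n\<close>.\<close>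

definition last_variable_class ::
  "nat \<Rightarrow> ((nat \<Rightarrow>\<^sub>0 nat) \<Rightarrow>\<^sub>0 'k::field) set \<Rightarrow> nat \<Rightarrow> ((nat \<Rightarrow>\<^sub>0 nat) \<Rightarrow>\<^sub>0 'k) set" where
  "last_variable_class n I i =
     I +>\<^bsub>mpoly_ring n\<^esub> (if i < n then monomial (Poly_Mapping.single (n - 1 - i) 1) else 0)"

lemma last_variable_class_linear: "last_variable_class n I i \<in> quotient_piece n I 1"
  by (auto simp: last_variable_class_def quotient_piece_def forms_def intro!: imageI single_in_exponents)

text \<open>A monomial of degree \<open>t\<close> either involves one of the last \<open>s\<close> variables, or it is a monomial in the
  first \<open>n - s\<close> variables and lies in \<open>I\<close>.\<close>

lemma last_variable_classes_generate:
  fixes I :: "((nat \<Rightarrow>\<^sub>0 nat) \<Rightarrow>\<^sub>0 'k::field) set"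
  assumes mono: "monomial_ideal n I" and abs: "first_variables_absorbed n I s t"
  shows "quotient_piece n I t \<subseteq> Idl\<^bsub>mpoly_ring n Quot I\<^esub> (last_variable_class n I ` {..<s})"
proof
  let ?R = "mpoly_ring n :: ((nat \<Rightarrow>\<^sub>0 nat) \<Rightarrow>\<^sub>0 'k) ring"
  let ?h = "\<lambda>f. I +>\<^bsub>?R\<^esub> f"
  let ?q = "Idl\<^bsub>?R Quot I\<^esub> (last_variable_class n I ` {..<s})"
  have I: "ideal I ?R" using mono by (rule monomial_ideal_is_ideal)
  interpret Q: ring "?R Quot I" using I by (rule ideal.quotient_is_ring)
  interpret h: ring_hom_ring ?R "?R Quot I" ?h using I by (rule ideal.rcos_ring_hom_ring)
  have gen: "last_variable_class n I ` {..<s} \<subseteq> carrier (?R Quot I)"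
    by (auto simp: last_variable_class_def intro!: h.hom_closed single_in_exponents)
  have q: "ideal ?q (?R Quot I)"
    using gen by (rule Q.genideal_ideal)
  \<comment> \<open>The preimage of the generated ideal in \<open>R\<close>, where monomials can be treated one by one.\<close>
  define P where "P = {f \<in> carrier ?R. ?h f \<in> ?q}"
  have P: "ideal P ?R"
    unfolding P_def using q by (rule h.ideal_vimage)
  note props = mpoly_ideal_props[OF P]
  have IP: "I \<subseteq> P"
  proof
    fix f assume f: "f \<in> I"
    then have "?h f = ?h 0"
      using h.R.quotient_eq_iff_same_a_r_cos[OF I, of f 0] mpoly_ring_minus[of f n 0]
        mpoly_ideal_props(1)[OF I] by auto
    also have "\<dots> = \<zero>\<^bsub>?R Quot I\<^esub>"
      using h.hom_zero by simp
    finally have "?h f = \<zero>\<^bsub>?R Quot I\<^esub>" .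
    moreover have "\<zero>\<^bsub>?R Quot I\<^esub> \<in> ?q"
      using additive_subgroup.zero_closed[OF ideal.axioms(1)[OF q]] .
    ultimately show "f \<in> P"
      using f mpoly_ideal_props(1)[OF I] by (auto simp: P_def)
  qed
  have monP: "monomial a \<in> P" if a: "a \<in> exponents n" "total_degree a = t" for a
  proof (cases "a \<in> exponents (n - s)")
    case True
    then show ?thesis
      using abs a(2) IP by (auto simp: first_variables_absorbed_def)
  next
    case False
    then have "\<not> Poly_Mapping.keys a \<subseteq> {..<n - s}"
      by (simp add: exponents_def)
    then obtain i where "i \<in> Poly_Mapping.keys a" "i \<notin> {..<n - s}"
      by blast
    then have i: "i \<in> Poly_Mapping.keys a" "i \<ge> n - s"
      by simp_all
    with a have "i < n" by (auto simp: exponents_def)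
    have "last_variable_class n I (n - 1 - i) \<in> ?q"
      using Q.genideal_self[OF gen] i \<open>i < n\<close> by auto
    then have "monomial (Poly_Mapping.single i 1) \<in> P"
      using \<open>i < n\<close> by (simp add: P_def last_variable_class_def single_in_exponents)
    moreover obtain b where "a = b + Poly_Mapping.single i (1::nat)" "Poly_Mapping.keys b \<subseteq> Poly_Mapping.keys a"
      using i(1) by (rule split_off_variable)
    ultimately show ?thesis
      using a(1) by (auto simp: monomial_add exponents_def intro!: props(5))
  qed
  fix Y assume "Y \<in> quotient_piece n I t"
  then obtain f where f: "f \<in> forms n t" "Y = ?h f"
    by (auto simp: quotient_piece_def)
  have "(\<Sum>a\<in>Poly_Mapping.keys f. Poly_Mapping.single 0 (Poly_Mapping.lookup f a) * monomial a) \<in> P"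
    using f(1) by (intro props(6) props(5) monP) (auto simp: forms_def)
  then have "f \<in> P"
    using poly_mapping_eq_sum_monomials[of f] by simp
  then show "Y \<in> ?q"
    using f(2) by (simp add: P_def)
qed

section \<open>A chain of primes\<close>

text \<open>The ideal generated by the first \<open>j\<close> variables.\<close>

definition variable_prime :: "nat \<Rightarrow> nat \<Rightarrow> ((nat \<Rightarrow>\<^sub>0 nat) \<Rightarrow>\<^sub>0 'k::field) set" where
  "variable_prime n j =
     {f. Poly_Mapping.keys f \<subseteq> {a \<in> exponents n. \<exists>i<j. Poly_Mapping.lookup a i \<noteq> 0}}"

text \<open>Modulo the ideal, \<open>f\<close> and \<open>g\<close> are congruent to their parts \<open>f0\<close> and \<open>g0\<close> without the first \<open>j\<close>
  variables. The product \<open>f0 * g0\<close> lies in the ideal but is free of these variables, so it is zero,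
  and the polynomial ring is a domain.\<close>

lemma variable_prime_is_prime:
  "primeideal (variable_prime n j :: ((nat \<Rightarrow>\<^sub>0 nat) \<Rightarrow>\<^sub>0 'k::field) set) (mpoly_ring n)"
proof (rule primeidealI)
  let ?R = "mpoly_ring n :: ((nat \<Rightarrow>\<^sub>0 nat) \<Rightarrow>\<^sub>0 'k) ring"
  let ?A = "{a. \<forall>i<j. Poly_Mapping.lookup a i = 0} :: (nat \<Rightarrow>\<^sub>0 nat) set"
  let ?P = "variable_prime n j :: ((nat \<Rightarrow>\<^sub>0 nat) \<Rightarrow>\<^sub>0 'k) set"
  show "cring ?R" by (rule cring_mpoly_ring)
  show P: "ideal ?P ?R"
    unfolding variable_prime_def
    by (rule ideal_of_exponent_set) (auto simp: lookup_add exponents_add)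
  note props = mpoly_ideal_props[OF P]
  have "1 \<notin> ?P" by (simp add: variable_prime_def)
  then show "carrier ?R \<noteq> ?P" by auto
  fix f g :: "(nat \<Rightarrow>\<^sub>0 nat) \<Rightarrow>\<^sub>0 'k"
  assume fg: "f \<in> carrier ?R" "g \<in> carrier ?R" "f \<otimes>\<^bsub>?R\<^esub> g \<in> ?P"
  obtain f0 where f0: "Poly_Mapping.keys f0 = Poly_Mapping.keys f \<inter> ?A"
    "Poly_Mapping.keys (f - f0) = Poly_Mapping.keys f - ?A"
    by (rule split_by_exponents)
  obtain g0 where g0: "Poly_Mapping.keys g0 = Poly_Mapping.keys g \<inter> ?A"
    "Poly_Mapping.keys (g - g0) = Poly_Mapping.keys g - ?A"
    by (rule split_by_exponents)
  have rest: "f - f0 \<in> ?P" "g - g0 \<in> ?P"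
    using f0(2) g0(2) fg(1,2) by (auto simp: variable_prime_def)
  have "f0 * g0 = f * g - (g * (f - f0) + f0 * (g - g0))"
    by (simp add: algebra_simps)
  moreover have "f * g \<in> ?P" using fg(3) by simp
  moreover have "g * (f - f0) \<in> ?P" "f0 * (g - g0) \<in> ?P"
    using fg f0(1) rest by (auto intro!: props(5))
  ultimately have "f0 * g0 \<in> ?P" by (auto intro: props(3,4))
  moreover have "Poly_Mapping.keys (f0 * g0) \<subseteq> ?A"
    using keys_mult[of f0 g0] f0(1) g0(1) by (fastforce simp: lookup_add)
  ultimately have "Poly_Mapping.keys (f0 * g0) = {}"
    by (fastforce simp: variable_prime_def)
  then have "f0 = 0 \<or> g0 = 0" by simp
  then show "f \<in> ?P \<or> g \<in> ?P" using rest by auto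
qed

text \<open>If the condition fails in all degrees, every monomial of \<open>I\<close> involves one of the first
  \<open>m = n - s - 1\<close> variables. Then the ideals generated by the first \<open>m, \<dots>, n\<close> variables all contain
  \<open>I\<close>, and their images form a chain of \<open>s + 2\<close> primes.\<close>

lemma first_variables_absorbed_eventually:
  fixes I :: "((nat \<Rightarrow>\<^sub>0 nat) \<Rightarrow>\<^sub>0 'k::field) set"
  assumes lex: "lex_segment_ideal n I" and dim: "krull_dim (mpoly_ring n Quot I) \<le> enat s"
  shows "\<exists>t. first_variables_absorbed n I s t"
proof (rule ccontr)
  assume "\<not> (\<exists>t. first_variables_absorbed n I s t)"
  then have not: "\<not> first_variables_absorbed n I s t" for t by blast
  then have "s < n"
    using first_variables_absorbed_if_few[of n s 1 I] by (meson not_less zero_less_one)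
  let ?R = "mpoly_ring n :: ((nat \<Rightarrow>\<^sub>0 nat) \<Rightarrow>\<^sub>0 'k) ring"
  let ?h = "\<lambda>f. I +>\<^bsub>?R\<^esub> f"
  have mono: "monomial_ideal n I" using lex by (simp add: lex_segment_ideal_def)
  have I: "ideal I ?R" using mono by (rule monomial_ideal_is_ideal)
  interpret R: cring ?R by (rule cring_mpoly_ring)
  define m where "m = n - s - 1"
  have sub: "I \<subseteq> variable_prime n (m + i)" for i
  proof
    fix f assume f: "f \<in> I"
    show "f \<in> variable_prime n (m + i)"
      unfolding variable_prime_def
    proof (rule CollectI, rule subsetI)
      fix a assume "a \<in> Poly_Mapping.keys f"
      then have a: "a \<in> exponents n" "monomial a \<in> I"
        using f monomial_ideal_mem_iff[OF mono, of f] by auto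
      then obtain k where "k < m" "Poly_Mapping.lookup a k \<noteq> 0"
        using last_variables_avoid_lex_segment[OF lex \<open>s < n\<close> not a(1) order_refl] by (auto simp: m_def)
      with a(1) show "a \<in> {a \<in> exponents n. \<exists>k<m + i. Poly_Mapping.lookup a k \<noteq> 0}"
        by (auto intro!: exI[of _ k])
    qed
  qed
  define C where "C i = ?h ` variable_prime n (m + i)" for i
  have prime: "primeideal (C i) (?R Quot I)" for i
    unfolding C_def
    by (rule R.primeideal_image_in_quotient[OF I variable_prime_is_prime sub])
  have strict: "C i \<subset> C (Suc i)" if "i < Suc s" for i
  proof (rule psubsetI)
    have "(variable_prime n (m + i) :: ((nat \<Rightarrow>\<^sub>0 nat) \<Rightarrow>\<^sub>0 'k) set) \<subseteq> variable_prime n (m + Suc i)"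
      unfolding variable_prime_def add_Suc_right
      by (rule Collect_mono) (blast intro: less_SucI)
    then show "C i \<subseteq> C (Suc i)"
      unfolding C_def by (rule image_mono)
    let ?x = "monomial (Poly_Mapping.single (m + i) 1) :: (nat \<Rightarrow>\<^sub>0 nat) \<Rightarrow>\<^sub>0 'k"
    have i: "m + i < n" using that \<open>s < n\<close> by (simp add: m_def)
    have mem: "?h ?x \<in> C k \<longleftrightarrow> ?x \<in> variable_prime n (m + k)" for k
      unfolding C_def using i
      by (intro R.coset_in_image_iff[OF I primeideal.axioms(1)[OF variable_prime_is_prime] sub])
        (simp add: single_in_exponents)
    have "?x \<in> variable_prime n (m + Suc i)" "?x \<notin> variable_prime n (m + i)"
      using i by (auto simp: variable_prime_def single_in_exponents lookup_single when_def)
    then show "C i \<noteq> C (Suc i)" using mem by metis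
  qed
  have "enat (Suc s) \<le> krull_dim (?R Quot I)"
    unfolding krull_dim_def using prime strict by (intro Sup_upper) blast
  then have "enat (Suc s) \<le> enat s" using dim by (rule order_trans)
  then show False by simp
qed

section \<open>The reduction number\<close>

theorem theorem2p4:
  fixes n s :: nat and I :: "((nat \<Rightarrow>\<^sub>0 nat) \<Rightarrow>\<^sub>0 'k::field) set"
  assumes "infinite (UNIV :: 'k set)"
    and "lex_segment_ideal n I"
    and "I \<noteq> carrier (mpoly_ring n)"
    and "krull_dim (mpoly_ring n Quot I) \<le> enat s"
  shows "(\<exists>q. s_reduction (mpoly_ring n Quot I) (quotient_piece n I) s q) \<and>
         (\<exists>t. hilbert_function n I t < (s + t) choose t) \<and>
         int (s_reduction_number (mpoly_ring n Quot I) (quotient_piece n I) s) =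
         int (LEAST t. hilbert_function n I t < (s + t) choose t) - 1"
proof -
  let ?Q = "mpoly_ring n Quot I" and ?G = "quotient_piece n I"
  let ?abs = "first_variables_absorbed n I s"
  have mono: "monomial_ideal n I" using assms(2) by (simp add: lex_segment_ideal_def)
  have less_iff: "hilbert_function n I t < (s + t) choose t \<longleftrightarrow> ?abs t" for t
    using assms(2,3) by (rule hilbert_function_less_iff)
  obtain t0 where t0: "?abs t0"
    using first_variables_absorbed_eventually[OF assms(2,4)] by blast
  define T where "T = (LEAST t. ?abs t)"
  have T: "?abs T" unfolding T_def using t0 by (rule LeastI)
  then have "T > 0" by (rule first_variables_absorbed_pos[OF mono assms(3)])
  define q where "q = Idl\<^bsub>?Q\<^esub> (last_variable_class n I ` {..<s})"
  have later: "q \<inter> ?G t = ?G t" if "T \<le> t" for t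
  proof -
    have "?abs t" using that T
      by (induction t rule: dec_induct) (auto intro: first_variables_absorbed_Suc[OF mono])
    then show ?thesis
      unfolding q_def using last_variable_classes_generate[OF mono] by blast
  qed
  have red: "s_reduction ?Q ?G s q"
    unfolding s_reduction_def q_def[symmetric]
    using later last_variable_class_linear by (auto simp: q_def intro!: exI[of _ "last_variable_class n I"])
  have "reduction_number ?G q \<le> T - 1"
    unfolding reduction_number_def using later[of T] \<open>T > 0\<close> by (intro Least_le) simp
  moreover have lower: "T - 1 \<le> reduction_number ?G q'" if q': "s_reduction ?Q ?G s q'" for q'
  proof -
    obtain z t1 where z: "\<And>i. i < s \<Longrightarrow> z i \<in> ?G 1" "q' = Idl\<^bsub>?Q\<^esub> (z ` {..<s})"
      and t1: "\<forall>t\<ge>t1. q' \<inter> ?G t = ?G t"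
      using q' unfolding s_reduction_def by blast
    let ?r = "reduction_number ?G q'"
    have "q' \<inter> ?G (?r + 1) = ?G (?r + 1)"
      unfolding reduction_number_def by (rule LeastI[of _ t1]) (simp add: t1)
    then have "?abs (?r + 1)"
      using z by (intro reduction_imp_first_variables_absorbed[OF assms(2), of _ _ z]) auto
    then have "T \<le> ?r + 1" unfolding T_def by (rule Least_le)
    then show ?thesis by simp
  qed
  ultimately have "reduction_number ?G q = T - 1"
    using red by (meson order_antisym)
  then have "s_reduction_number ?Q ?G s = T - 1"
    unfolding s_reduction_number_def using red lower by (intro Least_equality) auto
  then show ?thesis
    using red t0 \<open>T > 0\<close> unfolding less_iff T_def[symmetric] by (auto simp: of_nat_diff)
qed

end
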